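(* Let $G$ be a finite undirected graph (multiple edges and loops allowed). Then the semilattice of idempotents of the inverse semigroup $\mathrm{Fisg}(G)$, with the order $e\le f$ if and only if $e=ef$, forms a bi-Heyting algebra.
   Context: Graphs are finite and undirected and may have multiple edges and loops; the empty graph $\emptyset$ counts as a graph and the empty map $\mu_0:\emptyset\to\emptyset$ counts as a graph isomorphism. For a graph $G$, $\mathrm{Fisg}(G)$ is the set of all graph isomorphisms $\varphi:H\to J$ (bijections on vertices and on edges preserving incidence) where $H$ and $J$ are subgraphs of $G$. For $\varphi,\psi\in\mathrm{Fisg}(G)$ the product $\psi\circ\varphi$ is the composition of partial maps, with domain $\varphi^{-1}(\mathrm{Im}(\varphi)\cap\mathrm{Dom}(\psi))$ and image $\psi(\mathrm{Im}(\varphi)\cap\mathrm{Dom}(\psi))$. With this product $\mathrm{Fisg}(G)$ is an inverse semigroup. A bi-Heyting algebra is a bounded lattice that is a Heyting algebra and whose order dual is also a Heyting algebra. *)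

theory Defs
  imports "HOL-Algebra.Group" "HOL-Library.Uprod"
begin

section \<open>Finite undirected multigraphs with loops\<close>

text \<open>
  An edge \<open>e\<close> has the unordered pair \<open>ends G e\<close> of endpoints; \<open>Upair v v\<close> makes it a loop.
  The values of \<open>ends G\<close> outside \<open>edges G\<close> are irrelevant.
\<close>

record ('v, 'e) graph =
  verts :: "'v set"
  edges :: "'e set"
  ends :: "'e \<Rightarrow> 'v uprod"

locale finite_graph =
  fixes G :: "('v, 'e) graph"
  assumes finite_verts: "finite (verts G)"
    and finite_edges: "finite (edges G)"
    and ends_in_verts: "e \<in> edges G \<Longrightarrow> set_uprod (ends G e) \<subseteq> verts G"

definition subgraph :: "('v, 'e) graph \<Rightarrow> ('v, 'e) graph \<Rightarrow> bool" where
  "subgraph H G \<longleftrightarrow> finite_graph H \<and> verts H \<subseteq> verts G \<and> edges H \<subseteq> edges G \<and>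
     (\<forall>e \<in> edges H. ends H e = ends G e)"


section \<open>The inverse semigroup of partial graph isomorphisms\<close>

text \<open>
  A map between subgraphs is a pair of partial functions, one on vertices and one on edges, whose
  domains are the vertex set and the edge set of the source. For subgraphs of a fixed graph such a
  pair determines both its source and its image.
\<close>

type_synonym ('v, 'e) pmap = "('v \<rightharpoonup> 'v) \<times> ('e \<rightharpoonup> 'e)"

definition graph_iso :: "('v, 'e) graph \<Rightarrow> ('v, 'e) graph \<Rightarrow> ('v, 'e) pmap \<Rightarrow> bool" where
  "graph_iso H J \<phi> \<longleftrightarrow>
     dom (fst \<phi>) = verts H \<and> bij_betw (the \<circ> fst \<phi>) (verts H) (verts J) \<and>
     dom (snd \<phi>) = edges H \<and> bij_betw (the \<circ> snd \<phi>) (edges H) (edges J) \<and>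
     (\<forall>e \<in> edges H. ends J (the (snd \<phi> e)) = map_uprod (the \<circ> fst \<phi>) (ends H e))"

definition pmap_comp :: "('v, 'e) pmap \<Rightarrow> ('v, 'e) pmap \<Rightarrow> ('v, 'e) pmap" where
  "pmap_comp \<psi> \<phi> = (fst \<psi> \<circ>\<^sub>m fst \<phi>, snd \<psi> \<circ>\<^sub>m snd \<phi>)"

text \<open>
  The library has no record of semigroups, so its record of monoids is used: the identity
  map of \<open>G\<close> is a unit for the product.
\<close>

definition Fisg :: "('v, 'e) graph \<Rightarrow> ('v, 'e) pmap monoid" where
  "Fisg G =
     \<lparr> carrier = {\<phi>. \<exists>H J. subgraph H G \<and> subgraph J G \<and> graph_iso H J \<phi>},
       mult = pmap_comp,
       one = (Some |` verts G, Some |` edges G) \<rparr>"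

definition idempotents :: "('a, 'b) monoid_scheme \<Rightarrow> 'a set" where
  "idempotents S = {e \<in> carrier S. e \<otimes>\<^bsub>S\<^esub> e = e}"

definition idempotent_order :: "('a, 'b) monoid_scheme \<Rightarrow> 'a gorder" where
  "idempotent_order S =
     \<lparr> carrier = idempotents S, eq = (=), le = (\<lambda>e f. e = e \<otimes>\<^bsub>S\<^esub> f) \<rparr>"


section \<open>Bi-Heyting algebras\<close>

locale heyting_algebra = bounded_lattice +
  assumes rel_pseudocomplement_exists:
    "\<lbrakk>a \<in> carrier L; b \<in> carrier L\<rbrakk> \<Longrightarrow> \<exists>c. greatest L c {x \<in> carrier L. a \<sqinter> x \<sqsubseteq> b}"

locale bi_heyting_algebra =
  heyting_algebra L + dual: heyting_algebra "inv_gorder L" for L (structure)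

end

theory Submission
  imports Defs
begin

text \<open>
  An idempotent partial isomorphism is the identity of a subgraph, and the product of two such
  identities is the identity of the intersection. Hence the semilattice of idempotents is
  isomorphic to the lattice of subgraphs of \<open>G\<close> ordered by inclusion. Regarded as sets of
  vertices and edges, the subgraphs are closed under arbitrary unions and intersections. A family
  closed under arbitrary unions and binary intersections is a Heyting algebra, the relative
  pseudocomplement of \<open>A\<close> in \<open>B\<close> being the union of all \<open>X\<close> with \<open>A \<inter> X \<subseteq> B\<close>; the dual structure
  follows by passing to complements.
\<close>

text \<open>The map \<open>e\<close> transfers the order by inclusion to a carrier whose elements
  need not be sets. Its injectivity on \<open>D\<close> follows from \<open>le\<close> by
  reflexivity of inclusion.\<close>

lemma heyting_algebra_set_family:
  fixes D :: "'a set set" and e :: "'a set \<Rightarrow> 'b"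
  assumes Union: "\<And>F. F \<subseteq> D \<Longrightarrow> \<Union>F \<in> D"
    and Int: "\<And>A B. A \<in> D \<Longrightarrow> B \<in> D \<Longrightarrow> A \<inter> B \<in> D"
    and carrier: "carrier L = e ` D"
    and eq: "eq L = (=)"
    and le: "\<And>A B. A \<in> D \<Longrightarrow> B \<in> D \<Longrightarrow> e A \<sqsubseteq>\<^bsub>L\<^esub> e B \<longleftrightarrow> A \<subseteq> B"
  shows "heyting_algebra L"
proof -
  have po: "partial_order L"
    by unfold_locales (auto simp: carrier eq le)
  have glb: "greatest L (e (A \<inter> B)) (Lower L {e A, e B})" if "A \<in> D" "B \<in> D" for A B
    using that Int[OF that] by (auto simp: greatest_def Lower_def carrier le)
  have lub: "least L (e (A \<union> B)) (Upper L {e A, e B})" if "A \<in> D" "B \<in> D" for A B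
  proof -
    have "A \<union> B \<in> D"
      using Union[of "{A, B}"] that by simp
    then show ?thesis
      using that by (auto simp: least_def Upper_def carrier le)
  qed
  have top: "greatest L (e (\<Union>D)) (carrier L)"
    using Union[of D] by (auto simp: greatest_def carrier le)
  \<comment> \<open>The empty set belongs to \<open>D\<close> as the union of the empty
    family.\<close>
  have bot: "least L (e {}) (carrier L)"
    using Union[of "{}"] by (auto simp: least_def carrier le)
  interpret partial_order L by (rule po)
  interpret bounded_lattice L
  proof
    show "\<exists>s. least L s (Upper L {x, y})" if "x \<in> carrier L" "y \<in> carrier L" for x y
      using that lub unfolding carrier by blast
    show "\<exists>s. greatest L s (Lower L {x, y})" if "x \<in> carrier L" "y \<in> carrier L" for x y
      using that glb unfolding carrier by blast
    show "\<exists>x. greatest L x (carrier L)" "\<exists>x. least L x (carrier L)"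
      using top bot by blast+
  qed
  have meet: "e A \<sqinter>\<^bsub>L\<^esub> e B = e (A \<inter> B)" if "A \<in> D" "B \<in> D" for A B
  \<comment> \<open>The meet is a chosen greatest lower bound, so uniqueness is what identifies it
    with \<open>e (A \<inter> B)\<close>.\<close>
  proof (rule meetI)
    show "i = e (A \<inter> B)" if "greatest L i (Lower L {e A, e B})" for i
      using that glb[OF \<open>A \<in> D\<close> \<open>B \<in> D\<close>] by (rule greatest_unique)
  qed (use that in \<open>simp_all add: carrier\<close>)
  show ?thesis
  proof
    fix a b
    assume "a \<in> carrier L" "b \<in> carrier L"
    then obtain A B where AB: "A \<in> D" "B \<in> D" "a = e A" "b = e B"
      by (auto simp: carrier)
    define C where "C = \<Union>{X \<in> D. A \<inter> X \<subseteq> B}"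
    have "C \<in> D"
      unfolding C_def by (rule Union) auto
    \<comment> \<open>Intersection distributes over unions, so \<open>C\<close> satisfies the
      condition that defines the family it is the union of.\<close>
    moreover have "A \<inter> C \<subseteq> B"
      by (auto simp: C_def)
    moreover have "X \<subseteq> C" if "X \<in> D" "A \<inter> X \<subseteq> B" for X
      using that by (auto simp: C_def)
    ultimately have "greatest L (e C) {x \<in> carrier L. a \<sqinter>\<^bsub>L\<^esub> x \<sqsubseteq>\<^bsub>L\<^esub> b}"
      using AB by (auto simp: greatest_def carrier meet le Int)
    then show "\<exists>c. greatest L c {x \<in> carrier L. a \<sqinter>\<^bsub>L\<^esub> x \<sqsubseteq>\<^bsub>L\<^esub> b}" ..
  qed
qed

text \<open>Only nonempty intersections are required, because \<open>\<Inter>{}\<close> is the whole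
  type.\<close>

lemma bi_heyting_algebra_set_family:
  fixes D :: "'a set set" and e :: "'a set \<Rightarrow> 'b"
  assumes Union: "\<And>F. F \<subseteq> D \<Longrightarrow> \<Union>F \<in> D"
    and Inter: "\<And>F. F \<subseteq> D \<Longrightarrow> F \<noteq> {} \<Longrightarrow> \<Inter>F \<in> D"
    and carrier: "carrier L = e ` D"
    and eq: "eq L = (=)"
    and le: "\<And>A B. A \<in> D \<Longrightarrow> B \<in> D \<Longrightarrow> e A \<sqsubseteq>\<^bsub>L\<^esub> e B \<longleftrightarrow> A \<subseteq> B"
  shows "bi_heyting_algebra L"
proof -
  \<comment> \<open>Complementation in the largest member of \<open>D\<close> reverses inclusion and
    is undone by a second application, so \<open>e\<close> after \<open>c\<close> turns inclusion of
    complements into the dual order.\<close>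
  define c where "c = (\<lambda>A. \<Union>D - A)"
  have cc: "c (c A) = A" if "A \<in> D" for A
    using that by (auto simp: c_def)
  have "heyting_algebra L"
  proof (rule heyting_algebra_set_family[OF Union _ carrier eq le])
    show "A \<inter> B \<in> D" if "A \<in> D" "B \<in> D" for A B
      using Inter[of "{A, B}"] that by simp
  qed
  moreover have "heyting_algebra (inv_gorder L)"
  proof (rule heyting_algebra_set_family[where D = "c ` D" and e = "\<lambda>A. e (c A)"])
    show "\<Union>F \<in> c ` D" if "F \<subseteq> c ` D" for F
    proof (cases "F = {}")
      case True
      \<comment> \<open>The empty union is the complement of \<open>\<Union>D\<close>. De Morgan
        with \<open>Inter\<close> handles only nonempty families.\<close>
      have "\<Union>D \<in> D"
        by (rule Union) simp
      with True show ?thesis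
        by (auto simp: c_def image_iff)
    next
      case False
      from \<open>F \<subseteq> c ` D\<close> obtain H where H: "H \<subseteq> D" "F = c ` H"
        by (auto simp: subset_image_iff)
      with False have "\<Inter>H \<in> D"
        by (intro Inter) auto
      moreover have "\<Union>F = c (\<Inter>H)"
        using H by (auto simp: c_def)
      ultimately show ?thesis
        by blast
    qed
    show "A \<inter> B \<in> c ` D" if AB: "A \<in> c ` D" "B \<in> c ` D" for A B
    proof -
      from AB obtain X Y where XY: "X \<in> D" "Y \<in> D" "A = c X" "B = c Y"
        by auto
      then have "A \<inter> B = c (X \<union> Y)" "X \<union> Y \<in> D"
        using Union[of "{X, Y}"] by (auto simp: c_def)
      then show ?thesis
        by blast
    qed
    show "carrier (inv_gorder L) = (\<lambda>A. e (c A)) ` (c ` D)"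
      by (simp add: carrier image_image cc cong: image_cong)
    show "eq (inv_gorder L) = (=)"
      by (simp add: eq)
    show "e (c A) \<sqsubseteq>\<^bsub>inv_gorder L\<^esub> e (c B) \<longleftrightarrow> A \<subseteq> B" if AB: "A \<in> c ` D" "B \<in> c ` D" for A B
    proof -
      from AB obtain X Y where XY: "X \<in> D" "Y \<in> D" "A = c X" "B = c Y"
        by auto
      then have "Y \<subseteq> X \<longleftrightarrow> A \<subseteq> B"
        by (auto simp: c_def)
      with XY show ?thesis
        by (simp add: cc le)
    qed
  qed
  ultimately show ?thesis
    by (rule bi_heyting_algebra.intro)
qed

text \<open>The disjoint sum makes a subgraph a single set. Each instance of the endpoint condition
  has a single membership as premise, which is why unions preserve it as well as nonempty
  intersections.\<close>

definition subgraph_sets :: "('v, 'e) graph \<Rightarrow> ('v + 'e) set set" where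
  "subgraph_sets G = {S. S \<subseteq> verts G <+> edges G \<and>
     (\<forall>x. Inr x \<in> S \<longrightarrow> Inl ` set_uprod (ends G x) \<subseteq> S)}"

definition pmap_id :: "('v + 'e) set \<Rightarrow> ('v, 'e) pmap" where
  "pmap_id S = (Some |` (Inl -` S), Some |` (Inr -` S))"

lemma restrict_Some_comp: "(Some |` A) \<circ>\<^sub>m (Some |` B) = Some |` (A \<inter> B)"
  by (auto simp: map_comp_def restrict_map_def fun_eq_iff)

lemma restrict_Some_eq_iff: "Some |` A = Some |` B \<longleftrightarrow> A = B"
proof
  assume "Some |` A = Some |` B"
  then have "dom (Some |` A) = dom (Some |` B)"
    by simp
  then show "A = B"
    by (auto simp: dom_def restrict_map_def split: if_splits)
qed simp

lemma pmap_comp_pmap_id: "pmap_comp (pmap_id S) (pmap_id T) = pmap_id (S \<inter> T)"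
  by (simp add: pmap_comp_def pmap_id_def restrict_Some_comp vimage_Int)

lemma pmap_id_eq_iff: "pmap_id S = pmap_id T \<longleftrightarrow> S = T"
proof
  assume "pmap_id S = pmap_id T"
  then have "Inl -` S = Inl -` T" "Inr -` S = Inr -` T"
    by (simp_all add: pmap_id_def restrict_Some_eq_iff)
  then have "x \<in> S \<longleftrightarrow> x \<in> T" for x
    by (cases x) auto
  then show "S = T"
    by blast
qed simp

text \<open>If \<open>f x = Some y\<close>, idempotence gives \<open>f y = Some y\<close>. Then
  \<open>x\<close> and \<open>y\<close> have the same image, and injectivity forces
  \<open>x = y\<close>.\<close>

lemma idempotent_inj_map:
  assumes "f \<circ>\<^sub>m f = f" and "inj_on (the \<circ> f) (dom f)"
  shows "f = Some |` dom f"
proof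
  fix x
  show "f x = (Some |` dom f) x"
  proof (cases "f x")
    case (Some y)
    with fun_cong[OF assms(1), of x] have "f y = Some y"
      by simp
    with Some assms(2) have "x = y"
      by (auto simp: inj_on_def dom_def)
    with Some show ?thesis
      by (simp add: restrict_map_def dom_def)
  qed (auto simp: restrict_map_def dom_def)
qed

text \<open>The subgraph encoded by \<open>S\<close>, with endpoints inherited from
  \<open>G\<close>, serves as both source and image.\<close>

lemma pmap_id_in_Fisg:
  assumes "finite_graph G" and "S \<in> subgraph_sets G"
  shows "pmap_id S \<in> carrier (Fisg G)"
proof -
  interpret finite_graph G by fact
  define H where "H = \<lparr>verts = Inl -` S, edges = Inr -` S, ends = ends G\<rparr>"
  have S: "Inl -` S \<subseteq> verts G" "Inr -` S \<subseteq> edges G"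
      "\<And>x. Inr x \<in> S \<Longrightarrow> Inl ` set_uprod (ends G x) \<subseteq> S"
    using assms(2) by (auto simp: subgraph_sets_def)
  have "finite_graph H"
  proof
    show "finite (verts H)" "finite (edges H)"
      using S finite_verts finite_edges by (auto simp: H_def intro: finite_subset)
    show "set_uprod (ends H x) \<subseteq> verts H" if "x \<in> edges H" for x
      using S(3)[of x] that by (auto simp: H_def)
  qed
  then have "subgraph H G"
    using S by (auto simp: subgraph_def H_def)
  moreover have "graph_iso H H (pmap_id S)"
  proof -
    have bij: "bij_betw (the \<circ> Some |` A) A A" for A :: "'z set"
      by (rule bij_betw_cong[THEN iffD1, OF _ bij_betw_id]) simp
    have "map_uprod (the \<circ> Some |` (Inl -` S)) (ends G x) = ends G x" if "Inr x \<in> S" for x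
    proof -
      have "map_uprod (the \<circ> Some |` (Inl -` S)) (ends G x) = map_uprod id (ends G x)"
        \<comment> \<open>Agreement with \<open>id\<close> is needed only at the endpoints of
          \<open>x\<close>, and these lie in \<open>S\<close>.\<close>
        by (rule uprod.map_cong0) (use S(3)[OF that] in auto)
      then show ?thesis
        by (simp add: uprod.map_id)
    qed
    then show ?thesis
      by (auto simp: graph_iso_def H_def pmap_id_def bij)
  qed
  ultimately show ?thesis
    by (auto simp: Fisg_def)
qed

lemma idempotents_Fisg:
  assumes "finite_graph G"
  shows "idempotents (Fisg G) = pmap_id ` subgraph_sets G"
proof (intro equalityI subsetI)
  fix \<phi>
  assume "\<phi> \<in> idempotents (Fisg G)"
  then obtain H J where H: "subgraph H G" and iso: "graph_iso H J \<phi>"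
    and idem: "pmap_comp \<phi> \<phi> = \<phi>"
    by (auto simp: idempotents_def Fisg_def)
  have dom: "dom (fst \<phi>) = verts H" "dom (snd \<phi>) = edges H"
    and inj: "inj_on (the \<circ> fst \<phi>) (verts H)" "inj_on (the \<circ> snd \<phi>) (edges H)"
    using iso by (auto simp: graph_iso_def bij_betw_def)
  have "fst \<phi> \<circ>\<^sub>m fst \<phi> = fst \<phi>" "snd \<phi> \<circ>\<^sub>m snd \<phi> = snd \<phi>"
    using arg_cong[OF idem, of fst] arg_cong[OF idem, of snd] by (simp_all add: pmap_comp_def)
  then have "fst \<phi> = Some |` verts H" "snd \<phi> = Some |` edges H"
    using idempotent_inj_map[of "fst \<phi>"] idempotent_inj_map[of "snd \<phi>"] dom inj by simp_all
  moreover have "Inl -` (verts H <+> edges H) = verts H" "Inr -` (verts H <+> edges H) = edges H"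
    by auto
  ultimately have "\<phi> = pmap_id (verts H <+> edges H)"
    by (simp add: pmap_id_def prod_eq_iff)
  moreover have "verts H <+> edges H \<in> subgraph_sets G"
  proof -
    \<comment> \<open>On its edges \<open>H\<close> has the same endpoints as \<open>G\<close>, and
      \<open>H\<close> is itself a graph.\<close>
    have "set_uprod (ends G x) \<subseteq> verts H" if "x \<in> edges H" for x
      using H that finite_graph.ends_in_verts[of H x] by (simp add: subgraph_def)
    then show ?thesis
      using H by (auto simp: subgraph_sets_def subgraph_def)
  qed
  ultimately show "\<phi> \<in> pmap_id ` subgraph_sets G"
    by blast
next
  fix \<phi>
  assume "\<phi> \<in> pmap_id ` subgraph_sets G"
  then show "\<phi> \<in> idempotents (Fisg G)"
    using pmap_id_in_Fisg[OF assms]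
    by (auto simp: idempotents_def) (simp add: Fisg_def pmap_comp_pmap_id)
qed

theorem theorem3p2:
  fixes G :: "('v, 'e) graph"
  assumes "finite_graph G"
  shows "bi_heyting_algebra (idempotent_order (Fisg G))"
proof (rule bi_heyting_algebra_set_family[where D = "subgraph_sets G" and e = pmap_id])
  show "\<Union>F \<in> subgraph_sets G" if "F \<subseteq> subgraph_sets G" for F
    using that unfolding subgraph_sets_def by blast
  show "\<Inter>F \<in> subgraph_sets G" if "F \<subseteq> subgraph_sets G" "F \<noteq> {}" for F
    using that unfolding subgraph_sets_def by blast
  show "carrier (idempotent_order (Fisg G)) = pmap_id ` subgraph_sets G"
    by (simp add: idempotent_order_def idempotents_Fisg[OF assms])
  show "eq (idempotent_order (Fisg G)) = (=)"
    by (simp add: idempotent_order_def)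
  \<comment> \<open>The left side unfolds to \<open>pmap_id A = pmap_id (A \<inter> B)\<close>, and
    injectivity of \<open>pmap_id\<close> reduces it to \<open>A = A \<inter> B\<close>.\<close>
  show "pmap_id A \<sqsubseteq>\<^bsub>idempotent_order (Fisg G)\<^esub> pmap_id B \<longleftrightarrow> A \<subseteq> B" for A B
    by (auto simp: idempotent_order_def Fisg_def pmap_comp_pmap_id pmap_id_eq_iff)
qed

end
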